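(* Let $\widetilde R$ be a restriction mapping having at least one row in common with each $R^{(s)}$, $s \in \{1, \ldots, p\}$, let $\widetilde P = \widetilde R^{\mathsf T}$ and $\widetilde A = \widetilde R A \widetilde P$. Then, a two-level asynchronous Schwarz-type method (with shared/replicated coarse problem) $$\chi^{(s),k} := x^{(s),\delta_{s,s}(k)} + R^{(s)} \widetilde P \widetilde A^{-1} \left(\widetilde b - \sum_{r=1}^{p} \widetilde R A {R^{(r)}}^{\mathsf T} W^{(r)} x^{(r),\delta_{s,r}(k)}\right),$$ $$x^{(s),k+1} = \begin{cases} f^{(s)}\left(\chi^{(1),\delta_{s,1}(k)}, \ldots, \chi^{(p),\delta_{s,p}(k)}\right) & \forall s \in S_{k},\\ x^{(s),k} & \forall s \notin S_{k},\end{cases}$$ is convergent if $A$ is an $\mathsf M$-matrix.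
   Context: An $\mathsf M$-matrix is a nonsingular matrix with no positive off-diagonal entry which has a nonnegative inverse. The problem is $Ax=b$ with $A\in\mathbb{R}^{n\times n}$, $b\in\mathbb{R}^n$. The set $\Omega$ of the $n$ unknowns is distributed into $p\le n$ possibly overlapping subsets $\Omega^{(1)},\dots,\Omega^{(p)}$, where $\Omega^{(s)}$ has $n^{(s)}$ elements. $R^{(s)}$ is the unknowns selection mapping from $\Omega$ to $\Omega^{(s)}$, $A^{(s)}=R^{(s)}A{R^{(s)}}^{\mathsf T}$, $b^{(s)}=R^{(s)}b$, and for a vector $x\in\mathbb{R}^n$, $x^{(s)}:=R^{(s)}x$. $W^{(1)},\dots,W^{(p)}$ are diagonal weighting matrices such that $$\sum_{s=1}^{p} {R^{(s)}}^{\mathsf T} W^{(s)} R^{(s)} = I,$$ so that $x=\sum_{s=1}^{p} {R^{(s)}}^{\mathsf T} W^{(s)} x^{(s)}$ for every $x\in\mathbb{R}^n$. The one-level preconditioner is $M = \sum_{s=1}^{p} {R^{(s)}}^{\mathsf T} W^{(s)} M^{(s)} R^{(s)}$; it is of Schwarz type when $M^{(s)}={A^{(s)}}^{-1}$ for each $s$. The local mapping is $$f^{(s)}\left(x^{(1)}, \ldots, x^{(p)}\right) := x^{(s)} + M^{(s)} \left(b^{(s)} - \sum_{r=1}^{p} R^{(s)} A {R^{(r)}}^{\mathsf T} W^{(r)} x^{(r)}\right).$$ Coarse problem: $\widetilde R$ is a restriction mapping from the fine space to a coarse space, $\widetilde P$ is the prolongation mapping from the coarse space to the fine space, $\widetilde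 A$ is the coarse matrix, and $\widetilde b=\widetilde R b$. Asynchronous schedule: $x^{(s),k}$ denotes the $k$-th iterate of the $s$-th sub-vector; $S_k\subseteq\{1,\dots,p\}$ is the arbitrary set of sub-vectors updated at iteration $k$; and $\delta_{s,r}(k)\le k$ is the index of the (possibly outdated) iterate of component $r$ used by process $s$ at iteration $k$. These are required to satisfy, for all $s,r\in\{1,\dots,p\}$, $$\operatorname{card}\{k\in\mathbb{N} \mid s\in S_k\}=+\infty,\qquad \lim_{k\to+\infty}\delta_{s,r}(k)=+\infty.$$ Convergent means that, for any initial guess and any such schedule, the iterates $x^k=\sum_{s=1}^{p} {R^{(s)}}^{\mathsf T} W^{(s)} x^{(s),k}$ converge to the solution of $Ax=b$.
   Formalization: The weighting matrices are assumed to have diagonal entries 0 or 1 (one owner per unknown), and the restriction mapping R̃ is assumed to be a selection of unknowns; for general diagonal weights, or for arbitrary rows of R̃, the claim is false. *)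

theory Defs
  imports "Jordan_Normal_Form.Gauss_Jordan_Elimination" Complex_Main
begin

(* Only meaningful for invertible matrices. *)
definition mat_inv :: "real mat \<Rightarrow> real mat" where
  "mat_inv A = the (mat_inverse A)"

definition M_matrix :: "real mat \<Rightarrow> bool" where
  "M_matrix A \<longleftrightarrow> invertible_mat A
     \<and> (\<forall>i<dim_row A. \<forall>j<dim_row A. i \<noteq> j \<longrightarrow> A $$ (i, j) \<le> 0)
     \<and> (\<forall>i<dim_row A. \<forall>j<dim_row A. 0 \<le> mat_inv A $$ (i, j))"

(* R selects the unknowns in \<Omega>, each exactly once and in the order given by \<sigma>. *)
definition selection_mat :: "nat \<Rightarrow> nat set \<Rightarrow> real mat \<Rightarrow> bool" where
  "selection_mat n \<Omega> R \<longleftrightarrow> \<Omega> \<subseteq> {..<n} \<and> R \<in> carrier_mat (card \<Omega>) n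
     \<and> (\<exists>\<sigma>. bij_betw \<sigma> {..<card \<Omega>} \<Omega>
           \<and> (\<forall>i<card \<Omega>. \<forall>j<n. R $$ (i, j) = (if j = \<sigma> i then 1 else 0)))"

definition common_row :: "real mat \<Rightarrow> real mat \<Rightarrow> bool" where
  "common_row Q R \<longleftrightarrow> (\<exists>i<dim_row Q. \<exists>j<dim_row R. row Q i = row R j)"

definition diagonal_weights :: "nat \<Rightarrow> nat \<Rightarrow> (nat \<Rightarrow> real mat) \<Rightarrow> (nat \<Rightarrow> real mat) \<Rightarrow> bool" where
  "diagonal_weights n p R W \<longleftrightarrow>
     (\<forall>s\<in>{1..p}. W s \<in> carrier_mat (dim_row (R s)) (dim_row (R s)) \<and> diagonal_mat (W s))
     \<and> finsum (module_mat TYPE(real) n n)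
         (\<lambda>s. transpose_mat (R s) * W s * R s) {1..p} = 1\<^sub>m n"

(* R A R^T: the subdomain matrices and the coarse matrix. *)
definition restricted_mat :: "real mat \<Rightarrow> real mat \<Rightarrow> real mat" where
  "restricted_mat A R = R * A * transpose_mat R"

(* Q (b - A x), where x is the vector assembled from the sub-vectors y 1, ..., y p. *)
definition restricted_residual ::
  "nat \<Rightarrow> real mat \<Rightarrow> real vec \<Rightarrow> (nat \<Rightarrow> real mat) \<Rightarrow> (nat \<Rightarrow> real mat)
    \<Rightarrow> real mat \<Rightarrow> (nat \<Rightarrow> real vec) \<Rightarrow> real vec" where
  "restricted_residual p A b R W Q y = Q *\<^sub>v b
     - finsum_vec TYPE(real) (dim_row Q)
         (\<lambda>r. (Q * A * transpose_mat (R r) * W r) *\<^sub>v y r) {1..p}"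

definition local_map ::
  "nat \<Rightarrow> real mat \<Rightarrow> real vec \<Rightarrow> (nat \<Rightarrow> real mat) \<Rightarrow> (nat \<Rightarrow> real mat)
    \<Rightarrow> (nat \<Rightarrow> real mat) \<Rightarrow> nat \<Rightarrow> (nat \<Rightarrow> real vec) \<Rightarrow> real vec" where
  "local_map p A b R W M s y = y s + M s *\<^sub>v restricted_residual p A b R W (R s) y"

definition schwarz_local :: "real mat \<Rightarrow> (nat \<Rightarrow> real mat) \<Rightarrow> nat \<Rightarrow> real mat" where
  "schwarz_local A R s = mat_inv (restricted_mat A (R s))"

definition coarse_corrected ::
  "nat \<Rightarrow> real mat \<Rightarrow> real vec \<Rightarrow> (nat \<Rightarrow> real mat) \<Rightarrow> (nat \<Rightarrow> real mat) \<Rightarrow> real mat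
    \<Rightarrow> (nat \<Rightarrow> nat \<Rightarrow> nat \<Rightarrow> nat) \<Rightarrow> (nat \<Rightarrow> nat \<Rightarrow> real vec) \<Rightarrow> nat \<Rightarrow> nat \<Rightarrow> real vec" where
  "coarse_corrected p A b R W Rc \<delta> x s k = x s (\<delta> s s k)
     + (R s * transpose_mat Rc * mat_inv (restricted_mat A Rc))
         *\<^sub>v restricted_residual p A b R W Rc (\<lambda>r. x r (\<delta> s r k))"

definition async_schedule ::
  "nat \<Rightarrow> (nat \<Rightarrow> nat set) \<Rightarrow> (nat \<Rightarrow> nat \<Rightarrow> nat \<Rightarrow> nat) \<Rightarrow> bool" where
  "async_schedule p S \<delta> \<longleftrightarrow> (\<forall>k. S k \<subseteq> {1..p})
     \<and> (\<forall>s\<in>{1..p}. infinite {k. s \<in> S k})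
     \<and> (\<forall>s\<in>{1..p}. \<forall>r\<in>{1..p}. (\<forall>k. \<delta> s r k \<le> k) \<and> filterlim (\<delta> s r) at_top sequentially)"

(* x s k is the k-th iterate of the s-th sub-vector; the initial sub-vectors x s 0 are arbitrary. *)
definition two_level_schwarz_iterates ::
  "nat \<Rightarrow> real mat \<Rightarrow> real vec \<Rightarrow> (nat \<Rightarrow> real mat) \<Rightarrow> (nat \<Rightarrow> real mat) \<Rightarrow> real mat
    \<Rightarrow> (nat \<Rightarrow> nat set) \<Rightarrow> (nat \<Rightarrow> nat \<Rightarrow> nat \<Rightarrow> nat) \<Rightarrow> (nat \<Rightarrow> nat \<Rightarrow> real vec) \<Rightarrow> bool" where
  "two_level_schwarz_iterates p A b R W Rc S \<delta> x \<longleftrightarrow>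
     (\<forall>s\<in>{1..p}. x s 0 \<in> carrier_vec (dim_row (R s)))
     \<and> (\<forall>k. \<forall>s\<in>{1..p}. x s (Suc k) =
          (if s \<in> S k
           then local_map p A b R W (schwarz_local A R) s
                  (\<lambda>r. coarse_corrected p A b R W Rc \<delta> x r (\<delta> s r k))
           else x s k))"

definition assembled ::
  "nat \<Rightarrow> nat \<Rightarrow> (nat \<Rightarrow> real mat) \<Rightarrow> (nat \<Rightarrow> real mat) \<Rightarrow> (nat \<Rightarrow> real vec) \<Rightarrow> real vec" where
  "assembled n p R W y =
     finsum_vec TYPE(real) n (\<lambda>s. (transpose_mat (R s) * W s) *\<^sub>v y s) {1..p}"

definition two_level_schwarz_convergent ::
  "nat \<Rightarrow> nat \<Rightarrow> real mat \<Rightarrow> real vec \<Rightarrow> (nat \<Rightarrow> real mat) \<Rightarrow> (nat \<Rightarrow> real mat) \<Rightarrow> real mat \<Rightarrow> bool" where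
  "two_level_schwarz_convergent n p A b R W Rc \<longleftrightarrow>
     (\<exists>z\<in>carrier_vec n. A *\<^sub>v z = b
        \<and> (\<forall>S \<delta> x. async_schedule p S \<delta> \<longrightarrow> two_level_schwarz_iterates p A b R W Rc S \<delta> x \<longrightarrow>
             (\<forall>i<n. (\<lambda>k. assembled n p R W (\<lambda>s. x s k) $ i) \<longlonglongrightarrow> z $ i)))"

end

theory Submission
  imports Defs "Jordan_Normal_Form.Determinant"
begin

text \<open>Put \<open>w = A\<^sup>-\<^sup>1 1\<close>, so that \<open>w > 0\<close> and \<open>A w = 1\<close>. A subspace correction on a set
  \<open>\<Omega>\<close> of unknowns, be it local or coarse, replaces an error \<open>v\<close> by a vector \<open>d\<close> that agrees with
  \<open>v\<close> outside \<open>\<Omega>\<close> and satisfies \<open>(A d)\<^sub>i = 0\<close> on \<open>\<Omega>\<close>. Since \<open>A\<close> has no positive off-diagonal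
  entry, a comparison principle turns \<open>\<bar>v\<bar> \<le> \<beta> w\<close> into \<open>\<bar>d\<bar> \<le> \<theta> \<beta> w\<close> on \<open>\<Omega>\<close>, with \<open>\<theta> < 1\<close>
  depending only on \<open>A\<close>. As the weights are 0 or 1, every unknown has one owner, and only the owners'
  copies enter the residuals; for these the coarse step does not increase the bound and the local
  step gains the factor \<open>\<theta>\<close>. The delays tend to infinity and every sub-vector is updated
  infinitely often, so each bound \<open>\<theta>\<^sup>m \<beta> w\<close> eventually holds for good.\<close>

section \<open>Comparison and contraction on a set of unknowns\<close>

text \<open>A negative minimum \<open>t\<close> of \<open>d j / w j\<close> is attained at some
  \<open>i \<in> \<Omega>\<close>. The vector \<open>d - t * w\<close> is nonnegative and vanishes
  at \<open>i\<close>, so row \<open>i\<close> meets it only in off-diagonal entries and is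
  nonpositive there; then row \<open>i\<close> of \<open>d\<close> is negative, against
  \<open>ad\<close>.\<close>

lemma comparison_principle:
  fixes a :: "nat \<Rightarrow> nat \<Rightarrow> real" and w d :: "nat \<Rightarrow> real"
  assumes off: "\<And>i j. i \<in> \<Omega> \<Longrightarrow> j < n \<Longrightarrow> i \<noteq> j \<Longrightarrow> a i j \<le> 0"
    and w: "\<And>j. j < n \<Longrightarrow> 0 < w j"
    and aw: "\<And>i. i \<in> \<Omega> \<Longrightarrow> 0 < (\<Sum>j<n. a i j * w j)"
    and ad: "\<And>i. i \<in> \<Omega> \<Longrightarrow> 0 \<le> (\<Sum>j<n. a i j * d j)"
    and out: "\<And>i. i < n \<Longrightarrow> i \<notin> \<Omega> \<Longrightarrow> 0 \<le> d i"
    and k: "k < n"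
  shows "0 \<le> d k"
proof (rule ccontr)
  assume neg: "\<not> 0 \<le> d k"
  define t where "t = Min ((\<lambda>j. d j / w j) ` {..<n})"
  have fin: "finite ((\<lambda>j. d j / w j) ` {..<n})" and ne: "(\<lambda>j. d j / w j) ` {..<n} \<noteq> {}"
    using k by auto
  have t_le: "t \<le> d j / w j" if "j < n" for j
    unfolding t_def using fin that by simp
  have "t \<in> (\<lambda>j. d j / w j) ` {..<n}"
    unfolding t_def by (rule Min_in[OF fin ne])
  then obtain i where i: "i < n" and ti: "t = d i / w i" by auto
  have "d k / w k < 0" using neg w[OF k] by (simp add: divide_neg_pos)
  with t_le[OF k] have t0: "t < 0" by simp
  have di: "d i = t * w i" using w[OF i] ti by simp
  have "d i < 0" using di t0 w[OF i] by (simp add: mult_neg_pos)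
  then have iO: "i \<in> \<Omega>" using out[OF i] by force
  have "a i j * (d j - t * w j) \<le> 0" if j: "j < n" for j
  proof (cases "i = j")
    case True
    then show ?thesis using di by simp
  next
    case False
    have "t * w j \<le> d j" using t_le[OF j] w[OF j] by (simp add: pos_le_divide_eq)
    then show ?thesis using off[OF iO j False] by (simp add: mult_nonpos_nonneg)
  qed
  then have "(\<Sum>j<n. a i j * (d j - t * w j)) \<le> 0" by (intro sum_nonpos) auto
  moreover have "(\<Sum>j<n. a i j * (d j - t * w j))
      = (\<Sum>j<n. a i j * d j) - t * (\<Sum>j<n. a i j * w j)"
    by (simp add: algebra_simps sum_subtractf sum_distrib_left)
  moreover have "t * (\<Sum>j<n. a i j * w j) < 0" using t0 aw[OF iO] by (simp add: mult_neg_pos)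
  ultimately show False using ad[OF iO] by linarith
qed

text \<open>The slack lies in the row values 1 of \<open>w\<close>: lowering
  \<open>\<beta> * w\<close> by the fraction \<open>1 - \<theta>\<close> on \<open>\<Omega>\<close>
  costs a row at most \<open>\<beta>\<close>, so the lowered vector still has nonnegative rows on
  \<open>\<Omega>\<close> and dominates both \<open>d\<close> and \<open>- d\<close>.\<close>

lemma local_solve_contraction:
  fixes a :: "nat \<Rightarrow> nat \<Rightarrow> real" and w d :: "nat \<Rightarrow> real"
  assumes off: "\<And>i j. i \<in> \<Omega> \<Longrightarrow> j < n \<Longrightarrow> i \<noteq> j \<Longrightarrow> a i j \<le> 0"
    and sub: "\<Omega> \<subseteq> {..<n}"
    and w: "\<And>j. j < n \<Longrightarrow> 0 < w j"
    and aw: "\<And>i. i \<in> \<Omega> \<Longrightarrow> (\<Sum>j<n. a i j * w j) = 1"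
    and \<theta>: "\<theta> \<le> 1" "\<And>i. i \<in> \<Omega> \<Longrightarrow> (1 - \<theta>) * (\<Sum>j<n. \<bar>a i j\<bar> * w j) \<le> 1"
    and \<beta>: "0 \<le> \<beta>"
    and ad: "\<And>i. i \<in> \<Omega> \<Longrightarrow> (\<Sum>j<n. a i j * d j) = 0"
    and out: "\<And>j. j < n \<Longrightarrow> j \<notin> \<Omega> \<Longrightarrow> \<bar>d j\<bar> \<le> \<beta> * w j"
    and i: "i \<in> \<Omega>"
  shows "\<bar>d i\<bar> \<le> \<theta> * \<beta> * w i"
proof -
  (* Compare with a barrier that is only required to be \<theta> times smaller on \<Omega>. *)
  define g where "g j = (if j \<in> \<Omega> then \<theta> * \<beta> * w j else \<beta> * w j)" for j
  have ag: "0 \<le> (\<Sum>j<n. a k j * g j)" if k: "k \<in> \<Omega>" for k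
  proof -
    have g_eq: "g j = \<beta> * (w j - (1 - \<theta>) * (if j \<in> \<Omega> then w j else 0))" for j
      by (simp add: g_def algebra_simps)
    \<comment> \<open>Absolute values remove the restriction to \<open>\<Omega>\<close>, so one
      \<theta> computed from full rows suits every set of unknowns.\<close>
    have "a k j * (if j \<in> \<Omega> then w j else 0) \<le> \<bar>a k j\<bar> * w j" if "j < n" for j
      using w[OF that] by (simp add: mult_right_mono)
    then have "(\<Sum>j<n. a k j * (if j \<in> \<Omega> then w j else 0)) \<le> (\<Sum>j<n. \<bar>a k j\<bar> * w j)"
      by (intro sum_mono) auto
    then have "(1 - \<theta>) * (\<Sum>j<n. a k j * (if j \<in> \<Omega> then w j else 0)) \<le> 1"
      using \<theta>(1) \<theta>(2)[OF k] by (meson diff_ge_0_iff_ge mult_left_mono order_trans)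
    moreover have "(\<Sum>j<n. a k j * g j)
        = (\<Sum>j<n. \<beta> * (a k j * w j - (1 - \<theta>) * (a k j * (if j \<in> \<Omega> then w j else 0))))"
      unfolding g_eq by (rule sum.cong) (auto simp: algebra_simps)
    moreover have "\<dots> = \<beta> * (1 - (1 - \<theta>) * (\<Sum>j<n. a k j * (if j \<in> \<Omega> then w j else 0)))"
      using aw[OF k] by (simp add: sum_subtractf sum_distrib_left[symmetric])
    ultimately show ?thesis using \<beta> by simp
  qed
  have cmp: "0 \<le> g i + e * d i" if e: "e = 1 \<or> e = -1" for e :: real
  proof (rule comparison_principle[where d = "\<lambda>j. g j + e * d j", OF off w])
    show "0 \<le> (\<Sum>j<n. a k j * (g j + e * d j))" if k: "k \<in> \<Omega>" for k
    proof -
      have "(\<Sum>j<n. a k j * (g j + e * d j)) = (\<Sum>j<n. a k j * g j) + e * (\<Sum>j<n. a k j * d j)"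
        by (simp add: algebra_simps sum.distrib sum_distrib_left)
      then show ?thesis using ag[OF k] ad[OF k] by simp
    qed
    show "0 \<le> g j + e * d j" if "j < n" "j \<notin> \<Omega>" for j
      using out[OF that] that e by (auto simp: g_def)
  qed (use aw i sub in auto)
  from cmp[of 1] cmp[of "-1"] show ?thesis using i by (simp add: g_def)
qed

section \<open>Asynchronous convergence through nested levels\<close>

text \<open>This is the nested-set argument of Bertsekas: \<open>Q m s k\<close> places iterate
  \<open>k\<close> of sub-vector \<open>s\<close> in the \<open>m\<close>-th set. The delays in
  \<open>update\<close> are composed because a local step reads coarse-corrected vectors, which
  themselves read older iterates.\<close>

lemma async_level_convergence:
  assumes sched: "async_schedule p S \<delta>"
    and start: "\<And>s. s \<in> {1..p} \<Longrightarrow> Q 0 s 0"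
    and anti: "\<And>m s k. Q (Suc m) s k \<Longrightarrow> Q m s k"
    and idle: "\<And>m s k. s \<in> {1..p} \<Longrightarrow> s \<notin> S k \<Longrightarrow> Q m s k \<Longrightarrow> Q m s (Suc k)"
    and update: "\<And>m s k. s \<in> S k \<Longrightarrow>
      (\<And>r q. r \<in> {1..p} \<Longrightarrow> q \<in> {1..p} \<Longrightarrow> Q m q (\<delta> r q (\<delta> s r k))) \<Longrightarrow> Q (Suc m) s (Suc k)"
  shows "\<forall>\<^sub>F k in sequentially. \<forall>s\<in>{1..p}. Q m s k"
proof (induction m)
  case 0
  have \<delta>_le: "\<delta> s r k \<le> k" if "s \<in> {1..p}" "r \<in> {1..p}" for s r k
    using sched that by (auto simp: async_schedule_def)
  \<comment> \<open>Level 0 is needed at every index, as an update may read any earlier iterate. The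
    composed delay never exceeds \<open>l\<close>, so strong induction applies;
    \<open>update\<close> yields level 1, which \<open>anti\<close> weakens.\<close>
  have "\<forall>s\<in>{1..p}. Q 0 s k" for k
  proof (induction k rule: less_induct)
    case (less k)
    show ?case
    proof (cases k)
      case 0
      then show ?thesis using start by simp
    next
      case (Suc l)
      show ?thesis
      proof
        fix s assume s: "s \<in> {1..p}"
        show "Q 0 s k"
        proof (cases "s \<in> S l")
          case True
          have "Q 0 q (\<delta> r q (\<delta> s r l))" if "r \<in> {1..p}" "q \<in> {1..p}" for r q
            using less[of "\<delta> r q (\<delta> s r l)"] \<delta>_le[OF s that(1), of l]
              \<delta>_le[OF that, of "\<delta> s r l"] that Suc by auto
          then show ?thesis using anti update[OF True] Suc by blast
        next
          case False
          then show ?thesis using idle[OF s] less[of l] s Suc by auto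
        qed
      qed
    qed
  qed
  then show ?case by simp
next
  case (Suc m)
  then obtain K where K: "\<And>k s. K \<le> k \<Longrightarrow> s \<in> {1..p} \<Longrightarrow> Q m s k"
    unfolding eventually_sequentially by blast
  have lim: "filterlim (\<delta> s r) at_top sequentially" if "s \<in> {1..p}" "r \<in> {1..p}" for s r
    using sched that by (auto simp: async_schedule_def)
  have "\<forall>\<^sub>F k in sequentially. K \<le> \<delta> r q (\<delta> s r k)"
    if "s \<in> {1..p}" "r \<in> {1..p}" "q \<in> {1..p}" for s r q
    using filterlim_compose[OF lim[OF that(2,3)] lim[OF that(1,2)]]
    by (simp add: filterlim_at_top)
  then have "\<forall>\<^sub>F k in sequentially. \<forall>s\<in>{1..p}. \<forall>r\<in>{1..p}. \<forall>q\<in>{1..p}. K \<le> \<delta> r q (\<delta> s r k)"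
    by (simp add: eventually_ball_finite_distrib)
  then obtain L where L: "\<And>k s r q. L \<le> k \<Longrightarrow> s \<in> {1..p} \<Longrightarrow> r \<in> {1..p} \<Longrightarrow> q \<in> {1..p}
      \<Longrightarrow> K \<le> \<delta> r q (\<delta> s r k)"
    unfolding eventually_sequentially by blast
  have upd: "Q (Suc m) s (Suc k)" if "L \<le> k" "s \<in> S k" "s \<in> {1..p}" for s k
    using that update K L by blast
  have "\<forall>\<^sub>F k in sequentially. Q (Suc m) s k" if s: "s \<in> {1..p}" for s
  proof -
    have "infinite {k. s \<in> S k}" using sched s by (simp add: async_schedule_def)
    \<comment> \<open>An update at \<open>l\<close> reaches level \<open>Suc m\<close> at
      \<open>Suc l\<close>; afterwards idle steps keep the level and later updates produce it
      afresh.\<close>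
    then obtain l where l: "L \<le> l" "s \<in> S l" unfolding infinite_nat_iff_unbounded_le by auto
    have "Q (Suc m) s k" if "Suc l \<le> k" for k
      using that
    proof (induction k rule: dec_induct)
      case base
      then show ?case using upd[OF l s] .
    next
      case (step k)
      then show ?case using upd[of k s] idle[OF s, of k] s l(1) by (cases "s \<in> S k") auto
    qed
    then show ?thesis unfolding eventually_sequentially by blast
  qed
  then show ?case by (simp add: eventually_ball_finite_distrib)
qed

section \<open>Inverses and the positive vector of an M-matrix\<close>

lemma mat_inv_inverse:
  assumes A: "A \<in> carrier_mat n n" and det: "det A \<noteq> 0"
  shows "mat_inv A \<in> carrier_mat n n" "A * mat_inv A = 1\<^sub>m n" "mat_inv A * A = 1\<^sub>m n"
proof -
  \<comment> \<open>Both facts concern the units of a matrix ring record with a free extra field;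
    \<open>undefined\<close> fixes that field, so that the two rings coincide.\<close>
  have "mat_inverse A \<noteq> None"
    using mat_inverse(1)[OF A, of undefined] det_non_zero_imp_unit[OF A det, of undefined] by blast
  then obtain B where B: "mat_inverse A = Some B" by auto
  from mat_inverse(2)[OF A B] B
  show "mat_inv A \<in> carrier_mat n n" "A * mat_inv A = 1\<^sub>m n" "mat_inv A * A = 1\<^sub>m n"
    by (auto simp: mat_inv_def)
qed

lemma invertible_mat_det_nonzero:
  fixes A :: "'a :: idom mat"
  assumes "invertible_mat A"
  shows "det A \<noteq> 0"
proof -
  from assms obtain B where sq: "dim_row A = dim_col A" and B: "A * B = 1\<^sub>m (dim_row A)" "B * A = 1\<^sub>m (dim_row B)"
    by (auto simp: invertible_mat_def inverts_mat_def square_mat.simps)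
  have A: "A \<in> carrier_mat (dim_row A) (dim_row A)" using sq by auto
  have "dim_col B = dim_row A" using arg_cong[OF B(1), of dim_col] by simp
  moreover have "dim_row B = dim_row A" using arg_cong[OF B(2), of dim_col] sq by simp
  ultimately have "B \<in> carrier_mat (dim_row A) (dim_row A)" by auto
  from det_mult[OF A this] B(1) show ?thesis by auto
qed

lemma mult_mat_vec_index_sum:
  assumes "A \<in> carrier_mat m n" "v \<in> carrier_vec n" "i < m"
  shows "(A *\<^sub>v v) $ i = (\<Sum>j<n. A $$ (i, j) * v $ j)"
  using assms by (auto simp: scalar_prod_def lessThan_atLeast0)

text \<open>The witness is the vector of row sums of \<open>mat_inv A\<close>. Row \<open>i\<close>
  of this nonnegative matrix cannot vanish, since its product with column \<open>i\<close> of
  \<open>A\<close> is 1; hence its sum is positive.\<close>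

lemma M_matrix_positive_vector:
  assumes A: "A \<in> carrier_mat n n" and M: "M_matrix A"
  obtains w :: "nat \<Rightarrow> real" where "\<And>j. j < n \<Longrightarrow> 0 < w j"
    "\<And>i. i < n \<Longrightarrow> (\<Sum>j<n. A $$ (i, j) * w j) = 1"
proof -
  define e :: "real vec" where "e = vec n (\<lambda>_. 1)"
  have det: "det A \<noteq> 0" using M invertible_mat_det_nonzero by (auto simp: M_matrix_def)
  note inv = mat_inv_inverse[OF A det]
  have nonneg: "0 \<le> mat_inv A $$ (i, j)" if "i < n" "j < n" for i j
    using M A that by (auto simp: M_matrix_def)
  have e: "e \<in> carrier_vec n" by (simp add: e_def)
  have w_sum: "(mat_inv A *\<^sub>v e) $ i = (\<Sum>j<n. mat_inv A $$ (i, j))" if "i < n" for i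
    using mult_mat_vec_index_sum[OF inv(1) e that] by (simp add: e_def)
  show ?thesis
  proof
    fix i assume i: "i < n"
    have "(mat_inv A * A) $$ (i, i) = (\<Sum>j<n. mat_inv A $$ (i, j) * A $$ (j, i))"
      using inv(1) A i by (auto simp: scalar_prod_def lessThan_atLeast0)
    then have "(\<Sum>j<n. mat_inv A $$ (i, j) * A $$ (j, i)) \<noteq> 0" using i by (simp add: inv(3))
    then obtain j where j: "j < n" "mat_inv A $$ (i, j) \<noteq> 0"
      by (metis (mono_tags, lifting) lessThan_iff mult_zero_left sum.neutral)
    then have "0 < mat_inv A $$ (i, j)" using nonneg[OF i j(1)] by simp
    then have "0 < (\<Sum>j<n. mat_inv A $$ (i, j))"
      using nonneg[OF i] j(1) by (intro sum_pos2[where i = j]) auto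
    then show "0 < (mat_inv A *\<^sub>v e) $ i" using w_sum[OF i] by simp
  next
    fix i assume i: "i < n"
    have "A *\<^sub>v (mat_inv A *\<^sub>v e) = e"
      using assoc_mult_mat_vec[OF A inv(1) e] inv(2) e by simp
    then have "(A *\<^sub>v (mat_inv A *\<^sub>v e)) $ i = 1" using i by (simp add: e_def)
    then show "(\<Sum>j<n. A $$ (i, j) * (mat_inv A *\<^sub>v e) $ j) = 1"
      using mult_mat_vec_index_sum[OF A _ i] inv(1) e by simp
  qed
qed

section \<open>Selection matrices and subspace corrections\<close>

text \<open>Later arguments see a selection only through its action on vectors: reading along
  \<open>\<sigma>\<close>, and extension by zero for the transpose.\<close>

lemma selection_matE:
  assumes "selection_mat n \<Omega> R"
  obtains \<sigma> where "\<Omega> \<subseteq> {..<n}" "R \<in> carrier_mat (card \<Omega>) n" "bij_betw \<sigma> {..<card \<Omega>} \<Omega>"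
    "\<And>v i. v \<in> carrier_vec n \<Longrightarrow> i < card \<Omega> \<Longrightarrow> (R *\<^sub>v v) $ i = v $ \<sigma> i"
    "\<And>y i. y \<in> carrier_vec (card \<Omega>) \<Longrightarrow> i < card \<Omega> \<Longrightarrow> (transpose_mat R *\<^sub>v y) $ \<sigma> i = y $ i"
    "\<And>y j. y \<in> carrier_vec (card \<Omega>) \<Longrightarrow> j < n \<Longrightarrow> j \<notin> \<Omega> \<Longrightarrow> (transpose_mat R *\<^sub>v y) $ j = 0"
proof -
  from assms obtain \<sigma> where sub: "\<Omega> \<subseteq> {..<n}" and R: "R \<in> carrier_mat (card \<Omega>) n"
    and bij: "bij_betw \<sigma> {..<card \<Omega>} \<Omega>"
    and entry: "\<And>i j. i < card \<Omega> \<Longrightarrow> j < n \<Longrightarrow> R $$ (i, j) = (if j = \<sigma> i then 1 else 0)"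
    by (auto simp: selection_mat_def)
  have \<sigma>: "\<sigma> i \<in> \<Omega>" "\<sigma> i < n" if "i < card \<Omega>" for i
    using bij sub that by (auto simp: bij_betw_def)
  have inj: "\<sigma> i = \<sigma> k \<longleftrightarrow> i = k" if "i < card \<Omega>" "k < card \<Omega>" for i k
    using bij that by (auto simp: bij_betw_def inj_on_def)
  have Rt: "transpose_mat R \<in> carrier_mat n (card \<Omega>)" using R by simp
  show thesis
  proof
    fix v :: "real vec" and i assume v: "v \<in> carrier_vec n" and i: "i < card \<Omega>"
    have "(R *\<^sub>v v) $ i = (\<Sum>j<n. (if j = \<sigma> i then v $ j else 0))"
      unfolding mult_mat_vec_index_sum[OF R v i] by (rule sum.cong) (use entry i in auto)
    then show "(R *\<^sub>v v) $ i = v $ \<sigma> i" using \<sigma>(2)[OF i] by simp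
  next
    fix y :: "real vec" and i assume y: "y \<in> carrier_vec (card \<Omega>)" and i: "i < card \<Omega>"
    have "(transpose_mat R *\<^sub>v y) $ \<sigma> i = (\<Sum>k<card \<Omega>. (if k = i then y $ k else 0))"
      unfolding mult_mat_vec_index_sum[OF Rt y \<sigma>(2)[OF i]]
      by (rule sum.cong) (use entry \<sigma> inj R i in auto)
    then show "(transpose_mat R *\<^sub>v y) $ \<sigma> i = y $ i" using i by simp
  next
    fix y :: "real vec" and j assume y: "y \<in> carrier_vec (card \<Omega>)" and j: "j < n" "j \<notin> \<Omega>"
    show "(transpose_mat R *\<^sub>v y) $ j = 0"
      unfolding mult_mat_vec_index_sum[OF Rt y j(1)]
      by (rule sum.neutral) (use entry \<sigma> R j in auto)
  qed (fact sub R bij)+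
qed

lemma restricted_mat_mult_vec:
  assumes A: "A \<in> carrier_mat n n" and Q: "Q \<in> carrier_mat m n" and y: "y \<in> carrier_vec m"
  shows "restricted_mat A Q *\<^sub>v y = Q *\<^sub>v (A *\<^sub>v (transpose_mat Q *\<^sub>v y))"
proof -
  have Qt: "transpose_mat Q \<in> carrier_mat n m" using Q by simp
  have Qy: "transpose_mat Q *\<^sub>v y \<in> carrier_vec n" using Qt y by simp
  show ?thesis
    unfolding restricted_mat_def
    using assoc_mult_mat_vec[OF mult_carrier_mat[OF Q A] Qt y] assoc_mult_mat_vec[OF Q A Qy]
    by simp
qed

text \<open>A kernel vector of the restricted matrix, extended by zero, has vanishing rows on
  \<open>\<Omega>\<close> and vanishes outside, so the contraction estimate forces it to be 0. This
  gives \<open>mat_inv\<close> its meaning for subdomain and coarse matrices alike.\<close>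

lemma restricted_mat_det_nonzero:
  assumes A: "A \<in> carrier_mat n n"
    and off: "\<And>i j. i < n \<Longrightarrow> j < n \<Longrightarrow> i \<noteq> j \<Longrightarrow> A $$ (i, j) \<le> 0"
    and w: "\<And>j. j < n \<Longrightarrow> 0 < w j"
    and aw: "\<And>i. i < n \<Longrightarrow> (\<Sum>j<n. A $$ (i, j) * w j) = 1"
    and sel: "selection_mat n \<Omega> Q"
  shows "det (restricted_mat A Q) \<noteq> 0"
proof
  obtain \<sigma> where sub: "\<Omega> \<subseteq> {..<n}" and Q: "Q \<in> carrier_mat (card \<Omega>) n"
    and bij: "bij_betw \<sigma> {..<card \<Omega>} \<Omega>"
    and Qv: "\<And>v i. v \<in> carrier_vec n \<Longrightarrow> i < card \<Omega> \<Longrightarrow> (Q *\<^sub>v v) $ i = v $ \<sigma> i"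
    and Qt: "\<And>y i. y \<in> carrier_vec (card \<Omega>) \<Longrightarrow> i < card \<Omega> \<Longrightarrow> (transpose_mat Q *\<^sub>v y) $ \<sigma> i = y $ i"
    and Qo: "\<And>y j. y \<in> carrier_vec (card \<Omega>) \<Longrightarrow> j < n \<Longrightarrow> j \<notin> \<Omega> \<Longrightarrow> (transpose_mat Q *\<^sub>v y) $ j = 0"
    using selection_matE[OF sel] by metis
  have B: "restricted_mat A Q \<in> carrier_mat (card \<Omega>) (card \<Omega>)"
    using A Q by (simp add: restricted_mat_def)
  assume "det (restricted_mat A Q) = 0"
  then obtain y where y: "y \<in> carrier_vec (card \<Omega>)" "y \<noteq> 0\<^sub>v (card \<Omega>)"
    and By: "restricted_mat A Q *\<^sub>v y = 0\<^sub>v (card \<Omega>)"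
    using det_0_iff_vec_prod_zero_field[OF B] by auto
  define d where "d = transpose_mat Q *\<^sub>v y"
  have d: "d \<in> carrier_vec n" using Q y(1) by (simp add: d_def)
  have QAd: "Q *\<^sub>v (A *\<^sub>v d) = 0\<^sub>v (card \<Omega>)"
    using By restricted_mat_mult_vec[OF A Q y(1)] by (simp add: d_def)
  have Ad: "(\<Sum>j<n. A $$ (k, j) * d $ j) = 0" if k: "k \<in> \<Omega>" for k
  proof -
    from k bij obtain i where i: "i < card \<Omega>" "k = \<sigma> i" by (auto simp: bij_betw_def)
    have "(A *\<^sub>v d) $ k = 0" using Qv[of "A *\<^sub>v d" i] A d i QAd by simp
    then show ?thesis using mult_mat_vec_index_sum[OF A d] k sub by auto
  qed
  \<comment> \<open>With \<theta> = 1 and \<beta> = 0 the condition on \<theta> is trivial; the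
    product is left unevaluated to match the rule.\<close>
  have "\<bar>d $ k\<bar> \<le> 1 * 0 * w k" if "k \<in> \<Omega>" for k
    by (rule local_solve_contraction[where a = "\<lambda>i j. A $$ (i, j)" and n = n and \<Omega> = \<Omega>])
      (use off sub w aw Ad Qo[OF y(1)] that in \<open>auto simp: d_def\<close>)
  then have "y $ i = 0" if "i < card \<Omega>" for i
    using Qt[OF y(1) that] bij that by (force simp: d_def bij_betw_def)
  then show False using y by (metis carrier_vecD eq_vecI index_zero_vec)
qed

text \<open>The exact solve cancels the rows of \<open>A *\<^sub>v v\<close> on
  \<open>\<Omega>\<close>, and its extension by zero leaves \<open>v\<close> unchanged elsewhere, so
  the contraction estimate applies to \<open>d\<close>. The first bound serves the coarse step, the
  second the local one.\<close>

lemma subspace_correction_bound: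
  assumes A: "A \<in> carrier_mat n n"
    and off: "\<And>i j. i < n \<Longrightarrow> j < n \<Longrightarrow> i \<noteq> j \<Longrightarrow> A $$ (i, j) \<le> 0"
    and w: "\<And>j. j < n \<Longrightarrow> 0 < w j"
    and aw: "\<And>i. i < n \<Longrightarrow> (\<Sum>j<n. A $$ (i, j) * w j) = 1"
    and \<theta>: "\<theta> \<le> 1" "\<And>i. i < n \<Longrightarrow> (1 - \<theta>) * (\<Sum>j<n. \<bar>A $$ (i, j)\<bar> * w j) \<le> 1"
    and sel: "selection_mat n \<Omega> Q"
    and v: "v \<in> carrier_vec n" "\<And>j. j < n \<Longrightarrow> \<bar>v $ j\<bar> \<le> \<beta> * w j"
    and \<beta>: "0 \<le> \<beta>"
    and j: "j < n"
    and d_def: "d = v - transpose_mat Q *\<^sub>v (mat_inv (restricted_mat A Q) *\<^sub>v (Q *\<^sub>v (A *\<^sub>v v)))"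
  shows "\<bar>d $ j\<bar> \<le> \<beta> * w j" "j \<in> \<Omega> \<Longrightarrow> \<bar>d $ j\<bar> \<le> \<theta> * \<beta> * w j"
proof -
  obtain \<sigma> where sub: "\<Omega> \<subseteq> {..<n}" and Q: "Q \<in> carrier_mat (card \<Omega>) n"
    and bij: "bij_betw \<sigma> {..<card \<Omega>} \<Omega>"
    and Qv: "\<And>v i. v \<in> carrier_vec n \<Longrightarrow> i < card \<Omega> \<Longrightarrow> (Q *\<^sub>v v) $ i = v $ \<sigma> i"
    and Qo: "\<And>y j. y \<in> carrier_vec (card \<Omega>) \<Longrightarrow> j < n \<Longrightarrow> j \<notin> \<Omega> \<Longrightarrow> (transpose_mat Q *\<^sub>v y) $ j = 0"
    using selection_matE[OF sel] by metis
  let ?B = "restricted_mat A Q"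
  have B: "?B \<in> carrier_mat (card \<Omega>) (card \<Omega>)"
    using A Q by (simp add: restricted_mat_def)
  note inv = mat_inv_inverse[OF B restricted_mat_det_nonzero[OF A off w aw sel]]
  define y where "y = mat_inv ?B *\<^sub>v (Q *\<^sub>v (A *\<^sub>v v))"
  have QAv: "Q *\<^sub>v (A *\<^sub>v v) \<in> carrier_vec (card \<Omega>)" using A Q v by simp
  have y: "y \<in> carrier_vec (card \<Omega>)" using inv(1) QAv by (simp add: y_def)
  have Qy: "transpose_mat Q *\<^sub>v y \<in> carrier_vec n" using Q y by simp
  have d: "d \<in> carrier_vec n" using v(1) Qy by (simp add: d_def y_def[symmetric])
  have "Q *\<^sub>v (A *\<^sub>v (transpose_mat Q *\<^sub>v y)) = ?B *\<^sub>v y"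
    using restricted_mat_mult_vec[OF A Q y] by simp
  also have "\<dots> = Q *\<^sub>v (A *\<^sub>v v)"
    using assoc_mult_mat_vec[OF B inv(1) QAv] inv(2) QAv by (simp add: y_def)
  finally have "Q *\<^sub>v (A *\<^sub>v d) = 0\<^sub>v (card \<Omega>)"
    using A Q v(1) Qy QAv
    by (simp add: d_def y_def[symmetric] mult_minus_distrib_mat_vec[where nc = n])
  then have Ad: "(\<Sum>j<n. A $$ (k, j) * d $ j) = 0" if k: "k \<in> \<Omega>" for k
  proof -
    from k bij obtain i where i: "i < card \<Omega>" "k = \<sigma> i" by (auto simp: bij_betw_def)
    have "(A *\<^sub>v d) $ k = 0"
      using Qv[of "A *\<^sub>v d" i] A d i \<open>Q *\<^sub>v (A *\<^sub>v d) = 0\<^sub>v (card \<Omega>)\<close> by simp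
    then show ?thesis using mult_mat_vec_index_sum[OF A d] k sub by auto
  qed
  have d_out: "d $ k = v $ k" if "k < n" "k \<notin> \<Omega>" for k
    using Qo[OF y that] Q that by (simp add: d_def y_def[symmetric])
  have bound: "\<bar>d $ k\<bar> \<le> \<theta> * \<beta> * w k" if "k \<in> \<Omega>" for k
    by (rule local_solve_contraction[where a = "\<lambda>i j. A $$ (i, j)" and n = n and \<Omega> = \<Omega>])
      (use off sub w aw \<theta> \<beta> Ad d_out v(2) that in auto)
  then show "j \<in> \<Omega> \<Longrightarrow> \<bar>d $ j\<bar> \<le> \<theta> * \<beta> * w j" .
  have "\<theta> * (\<beta> * w j) \<le> \<beta> * w j"
    using mult_right_mono[OF \<theta>(1), of "\<beta> * w j"] \<beta> w[OF j] by simp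
  then show "\<bar>d $ j\<bar> \<le> \<beta> * w j"
    using bound[of j] d_out[OF j] v(2)[OF j] by (cases "j \<in> \<Omega>") (auto simp: mult.assoc)
qed


section \<open>Weights, owners and residuals\<close>

text \<open>The diagonal entry at \<open>j\<close> is the weight that the subdomain gives to unknown
  \<open>j\<close>, and 0 if \<open>j\<close> lies outside. It is expressed through the triple
  product because the partition of unity sums these products.\<close>

lemma weighted_extension_entry:
  fixes R W :: "real mat"
  assumes sel: "selection_mat n \<Omega> R"
    and W: "W \<in> carrier_mat (card \<Omega>) (card \<Omega>)" "diagonal_mat W"
    and W01: "\<forall>i<card \<Omega>. W $$ (i, i) \<in> {0, 1}"
    and j: "j < n"
  shows "(transpose_mat R * W * R) $$ (j, j) \<in> {0, 1}"
    and "(transpose_mat R * W * R) $$ (j, j) \<noteq> 0 \<Longrightarrow> j \<in> \<Omega>"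
    and "y \<in> carrier_vec (card \<Omega>) \<Longrightarrow> ((transpose_mat R * W) *\<^sub>v y) $ j
      = (transpose_mat R * W * R) $$ (j, j) * (transpose_mat R *\<^sub>v y) $ j"
proof -
  obtain \<sigma> where R: "R \<in> carrier_mat (card \<Omega>) n"
    and bij: "bij_betw \<sigma> {..<card \<Omega>} \<Omega>"
    and Rv: "\<And>v i. v \<in> carrier_vec n \<Longrightarrow> i < card \<Omega> \<Longrightarrow> (R *\<^sub>v v) $ i = v $ \<sigma> i"
    and Rt: "\<And>y i. y \<in> carrier_vec (card \<Omega>) \<Longrightarrow> i < card \<Omega> \<Longrightarrow> (transpose_mat R *\<^sub>v y) $ \<sigma> i = y $ i"
    and Ro: "\<And>y j. y \<in> carrier_vec (card \<Omega>) \<Longrightarrow> j < n \<Longrightarrow> j \<notin> \<Omega> \<Longrightarrow> (transpose_mat R *\<^sub>v y) $ j = 0"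
    using selection_matE[OF sel] by metis
  have Wy: "(W *\<^sub>v y) $ i = W $$ (i, i) * y $ i" if y: "y \<in> carrier_vec (card \<Omega>)" and i: "i < card \<Omega>" for y i
  proof -
    have "(W *\<^sub>v y) $ i = (\<Sum>k<card \<Omega>. if k = i then W $$ (i, i) * y $ i else 0)"
      unfolding mult_mat_vec_index_sum[OF W(1) y i]
      by (rule sum.cong) (use W i in \<open>auto simp: diagonal_mat_def\<close>)
    then show ?thesis using i by simp
  qed
  have RW: "(transpose_mat R * W) *\<^sub>v y = transpose_mat R *\<^sub>v (W *\<^sub>v y)"
    if "y \<in> carrier_vec (card \<Omega>)" for y
    using R W(1) that by simp
  \<comment> \<open>As an action on a unit vector, the entry can be evaluated by the rules for
    \<open>R\<close>, its transpose and \<open>W\<close> on vectors.\<close>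
  have diag: "(transpose_mat R * W * R) $$ (j, j) = ((transpose_mat R * W) *\<^sub>v (R *\<^sub>v unit_vec n j)) $ j"
  proof -
    have RWR: "transpose_mat R * W * R \<in> carrier_mat n n" using R W(1) by simp
    have "((transpose_mat R * W) *\<^sub>v (R *\<^sub>v unit_vec n j)) = (transpose_mat R * W * R) *\<^sub>v unit_vec n j"
      using assoc_mult_mat_vec[OF _ R unit_vec_carrier, of "transpose_mat R * W" n] R W(1) by simp
    also have "\<dots> $ j = (\<Sum>k<n. if k = j then (transpose_mat R * W * R) $$ (j, j) else 0)"
      unfolding mult_mat_vec_index_sum[OF RWR unit_vec_carrier j]
      by (rule sum.cong) (use j in auto)
    finally show ?thesis using j by simp
  qed
  have Ru: "R *\<^sub>v unit_vec n j \<in> carrier_vec (card \<Omega>)" using R by simp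
  have "j \<in> \<sigma> ` {..<card \<Omega>} \<longleftrightarrow> j \<in> \<Omega>" using bij by (simp add: bij_betw_def)
  then consider "j \<notin> \<Omega>" | i where "i < card \<Omega>" "j = \<sigma> i" "j \<in> \<Omega>" by blast
  then have "(transpose_mat R * W * R) $$ (j, j) \<in> {0, 1}
    \<and> ((transpose_mat R * W * R) $$ (j, j) \<noteq> 0 \<longrightarrow> j \<in> \<Omega>)
    \<and> (\<forall>y\<in>carrier_vec (card \<Omega>). ((transpose_mat R * W) *\<^sub>v y) $ j
      = (transpose_mat R * W * R) $$ (j, j) * (transpose_mat R *\<^sub>v y) $ j)"
  proof cases
    case 1
    have "((transpose_mat R * W) *\<^sub>v y) $ j = 0" if "y \<in> carrier_vec (card \<Omega>)" for y
      unfolding RW[OF that] by (rule Ro) (use W(1) that j 1 in auto)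
    then show ?thesis using diag Ru Ro[OF _ j 1] by simp
  next
    case (2 i)
    have ext: "((transpose_mat R * W) *\<^sub>v y) $ j = W $$ (i, i) * y $ i" if "y \<in> carrier_vec (card \<Omega>)" for y
      unfolding RW[OF that] using Rt[of "W *\<^sub>v y" i] Wy[OF that 2(1)] W(1) that 2 by simp
    have "(transpose_mat R * W * R) $$ (j, j) = W $$ (i, i)"
      using diag ext[OF Ru] Rv[OF _ 2(1), of "unit_vec n j"] 2 j by simp
    then show ?thesis using ext Rt[OF _ 2(1)] W01 2 by auto
  qed
  then show "(transpose_mat R * W * R) $$ (j, j) \<in> {0, 1}"
    "(transpose_mat R * W * R) $$ (j, j) \<noteq> 0 \<Longrightarrow> j \<in> \<Omega>"
    "y \<in> carrier_vec (card \<Omega>) \<Longrightarrow> ((transpose_mat R * W) *\<^sub>v y) $ j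
      = (transpose_mat R * W * R) $$ (j, j) * (transpose_mat R *\<^sub>v y) $ j"
    by blast+
qed

lemma finsum_module_mat_index:
  fixes f :: "'b \<Rightarrow> 'a :: comm_ring_1 mat"
  assumes "finite F" "f \<in> F \<rightarrow> carrier_mat m n" "i < m" "j < n"
  shows "finsum (module_mat TYPE('a) m n) f F $$ (i, j) = (\<Sum>x\<in>F. f x $$ (i, j))"
proof -
  interpret abelian_group "module_mat TYPE('a) m n" by (rule abelian_group_mat)
  from assms(1,2) show ?thesis
  proof (induction F)
    case empty
    then show ?case using assms(3,4) finsum_empty[of f] by (simp add: module_mat_simps)
  next
    case (insert x F)
    then have c: "f \<in> F \<rightarrow> carrier (module_mat TYPE('a) m n)" "f x \<in> carrier (module_mat TYPE('a) m n)"
      by (auto simp: module_mat_simps)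
    have "finsum (module_mat TYPE('a) m n) f F \<in> carrier_mat m n"
      using finsum_closed[OF c(1)] by (simp add: module_mat_simps)
    then show ?case
      using finsum_insert[OF insert(1,2) c] insert assms(3,4) by (simp add: module_mat_simps)
  qed
qed

lemma weighted_extension_carrier:
  "R \<in> carrier_mat m n \<Longrightarrow> (transpose_mat R * W) *\<^sub>v y \<in> carrier_vec n"
  by (intro carrier_vecI) simp

lemma assembled_index:
  assumes "\<And>r. r \<in> {1..p} \<Longrightarrow> R r \<in> carrier_mat (m r) n"
    and "\<And>r. r \<in> {1..p} \<Longrightarrow> W r \<in> carrier_mat (m r) (m r)"
    and "j < n"
  shows "assembled n p R W y $ j = (\<Sum>r=1..p. ((transpose_mat (R r) * W r) *\<^sub>v y r) $ j)"
  unfolding assembled_def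
  using weighted_extension_carrier[OF assms(1)] assms(3) by (intro index_finsum_vec) auto

lemma assembled_carrier:
  assumes "\<And>r. r \<in> {1..p} \<Longrightarrow> R r \<in> carrier_mat (m r) n"
  shows "assembled n p R W y \<in> carrier_vec n"
  unfolding assembled_def
  using weighted_extension_carrier[OF assms] by (intro finsum_vec_closed) auto

text \<open>At a fixed unknown the weights are 0 or 1 and sum to 1, so exactly one subdomain carries
  weight 1. It is chosen before \<open>y\<close>, as the weights do not depend on the iterates, and
  thus stays the same for all time.\<close>

lemma assembled_owner:
  assumes sel: "\<forall>s\<in>{1..p}. selection_mat n (\<Omega> s) (R s)"
    and diag: "diagonal_weights n p R W"
    and W01: "\<forall>s\<in>{1..p}. \<forall>i<dim_row (W s). W s $$ (i, i) \<in> {0, 1}"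
    and j: "j < n"
  obtains s where "s \<in> {1..p}" "j \<in> \<Omega> s"
    "\<And>y. (\<And>r. r \<in> {1..p} \<Longrightarrow> y r \<in> carrier_vec (card (\<Omega> r))) \<Longrightarrow>
       assembled n p R W y $ j = (transpose_mat (R s) *\<^sub>v y s) $ j"
proof -
  have R: "R r \<in> carrier_mat (card (\<Omega> r)) n" if "r \<in> {1..p}" for r
    using sel that by (auto simp: selection_mat_def)
  have W: "W r \<in> carrier_mat (card (\<Omega> r)) (card (\<Omega> r))" "diagonal_mat (W r)" if "r \<in> {1..p}" for r
    using diag R[OF that] that unfolding diagonal_weights_def by (metis carrier_matD(1))+
  let ?c = "\<lambda>r. (transpose_mat (R r) * W r * R r) $$ (j, j)"
  have carrier: "transpose_mat (R r) * W r * R r \<in> carrier_mat n n" if "r \<in> {1..p}" for r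
    using R[OF that] by (intro carrier_matI) simp_all
  have W01': "\<forall>i<card (\<Omega> r). W r $$ (i, i) \<in> {0, 1}" if "r \<in> {1..p}" for r
    using W01 W(1)[OF that] that by auto
  note entry = weighted_extension_entry[OF sel[rule_format] W W01' j]
  have "finsum (module_mat TYPE(real) n n) (\<lambda>s. transpose_mat (R s) * W s * R s) {1..p} $$ (j, j)
      = (\<Sum>r=1..p. ?c r)"
    by (rule finsum_module_mat_index) (use carrier j in auto)
  then have sum: "(\<Sum>r=1..p. ?c r) = 1"
    using diag j by (simp add: diagonal_weights_def)
  then obtain s where s: "s \<in> {1..p}" "?c s \<noteq> 0"
    by (metis (no_types, lifting) sum.neutral zero_neq_one)
  then have cs: "?c s = 1" using entry(1)[of s] by auto
  have "(\<Sum>r=1..p. ?c r) = ?c s + (\<Sum>r\<in>{1..p} - {s}. ?c r)"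
    by (rule sum.remove) (use s(1) in auto)
  then have "(\<Sum>r\<in>{1..p} - {s}. ?c r) = 0" using sum cs by linarith
  moreover have "0 \<le> ?c r" if "r \<in> {1..p} - {s}" for r
    using entry(1)[of r] that by auto
  ultimately have "\<forall>r\<in>{1..p} - {s}. ?c r = 0"
    by (subst (asm) sum_nonneg_eq_0_iff) auto
  then have c0: "?c r = 0" if "r \<in> {1..p} - {s}" for r using that by blast
  show thesis
  proof
    fix y :: "nat \<Rightarrow> real vec"
    assume y: "\<And>r. r \<in> {1..p} \<Longrightarrow> y r \<in> carrier_vec (card (\<Omega> r))"
    have "assembled n p R W y $ j = (\<Sum>r=1..p. ?c r * (transpose_mat (R r) *\<^sub>v y r) $ j)"
      using assembled_index[of p R "\<lambda>r. card (\<Omega> r)" n W j y, OF R W(1) j] entry(3) y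
      by (auto intro!: sum.cong)
    also have "\<dots> = (\<Sum>r=1..p. if r = s then (transpose_mat (R s) *\<^sub>v y s) $ j else 0)"
      by (rule sum.cong) (use cs c0 in auto)
    finally show "assembled n p R W y $ j = (transpose_mat (R s) *\<^sub>v y s) $ j"
      using s(1) by simp
  qed (use s entry(2) in auto)
qed

text \<open>Since \<open>b\<close> is \<open>A *\<^sub>v z\<close>, linearity makes the residual the
  image of the global error, so the iteration can be followed through errors alone.\<close>

lemma restricted_residual_eq:
  assumes A: "A \<in> carrier_mat n n" and z: "z \<in> carrier_vec n" "A *\<^sub>v z = b"
    and Q: "Q \<in> carrier_mat m n"
    and R: "\<And>r. r \<in> {1..p} \<Longrightarrow> R r \<in> carrier_mat (l r) n"
    and W: "\<And>r. r \<in> {1..p} \<Longrightarrow> W r \<in> carrier_mat (l r) (l r)"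
    and y: "\<And>r. r \<in> {1..p} \<Longrightarrow> y r \<in> carrier_vec (l r)"
  shows "restricted_residual p A b R W Q y = Q *\<^sub>v (A *\<^sub>v (z - assembled n p R W y))"
proof -
  have asm: "assembled n p R W y \<in> carrier_vec n" by (rule assembled_carrier) (rule R)
  have QA: "Q * A \<in> carrier_mat m n" using Q A by simp
  have closed: "(Q * A * transpose_mat (R r) * W r) *\<^sub>v y r \<in> carrier_vec m" for r
    using Q by (intro carrier_vecI) simp
  \<comment> \<open>The matrix is moved out of the vector sum entry by entry, by exchanging the sums
    over \<open>r\<close> and \<open>j\<close>.\<close>
  have "finsum_vec TYPE(real) m (\<lambda>r. (Q * A * transpose_mat (R r) * W r) *\<^sub>v y r) {1..p}
      = (Q * A) *\<^sub>v assembled n p R W y" (is "?F = _")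
  proof (rule eq_vecI)
    fix i assume "i < dim_vec ((Q * A) *\<^sub>v assembled n p R W y)"
    then have i: "i < m" using Q by simp
    have term_eq: "((Q * A * transpose_mat (R r) * W r) *\<^sub>v y r) $ i
        = (\<Sum>j<n. (Q * A) $$ (i, j) * ((transpose_mat (R r) * W r) *\<^sub>v y r) $ j)"
      if r: "r \<in> {1..p}" for r
    proof -
      have v: "(transpose_mat (R r) * W r) *\<^sub>v y r \<in> carrier_vec n"
        by (rule weighted_extension_carrier[OF R[OF r]])
      have "Q * A * transpose_mat (R r) * W r = Q * A * (transpose_mat (R r) * W r)"
        using assoc_mult_mat[OF QA _ W[OF r]] R[OF r] by simp
      then have "(Q * A * transpose_mat (R r) * W r) *\<^sub>v y r
          = (Q * A) *\<^sub>v ((transpose_mat (R r) * W r) *\<^sub>v y r)"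
        using assoc_mult_mat_vec[OF QA _ y[OF r]] R[OF r] W[OF r] by simp
      then show ?thesis using mult_mat_vec_index_sum[OF QA v i] by simp
    qed
    have "?F $ i = (\<Sum>r=1..p. ((Q * A * transpose_mat (R r) * W r) *\<^sub>v y r) $ i)"
      using closed i by (intro index_finsum_vec) auto
    also have "\<dots> = (\<Sum>r=1..p. \<Sum>j<n. (Q * A) $$ (i, j) * ((transpose_mat (R r) * W r) *\<^sub>v y r) $ j)"
      using term_eq by (rule sum.cong[OF refl])
    also have "\<dots> = (\<Sum>j<n. (Q * A) $$ (i, j) * assembled n p R W y $ j)"
      using assembled_index[of p R l n W _ y] R W
      by (subst sum.swap) (simp add: sum_distrib_left)
    also have "\<dots> = ((Q * A) *\<^sub>v assembled n p R W y) $ i"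
      by (rule mult_mat_vec_index_sum[OF QA asm i, symmetric])
    finally show "?F $ i = ((Q * A) *\<^sub>v assembled n p R W y) $ i" .
  next
    have "?F \<in> carrier_vec m" using closed by (intro finsum_vec_closed) auto
    then show "dim_vec ?F = dim_vec ((Q * A) *\<^sub>v assembled n p R W y)" using Q by simp
  qed
  then have "restricted_residual p A b R W Q y = Q *\<^sub>v (A *\<^sub>v z) - Q *\<^sub>v (A *\<^sub>v assembled n p R W y)"
    using Q A asm z by (simp add: restricted_residual_def)
  also have "\<dots> = Q *\<^sub>v (A *\<^sub>v (z - assembled n p R W y))"
    using Q A asm z(1) by (simp add: mult_minus_distrib_mat_vec[where nc = n])
  finally show ?thesis .
qed

section \<open>Error bounds for the two-level iteration\<close>

text \<open>The context gathers what is constructed once: the positive vector \<open>w\<close>, one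
  factor \<open>\<theta>\<close> for all subspaces, the solution \<open>z\<close>, and for each
  unknown the subdomain whose copy enters the assembled vector.\<close>

locale two_level_schwarz =
  fixes n p :: nat and A Rc :: "real mat" and b z :: "real vec"
    and \<Omega> :: "nat \<Rightarrow> nat set" and \<Omega>c :: "nat set" and R W :: "nat \<Rightarrow> real mat"
    and w :: "nat \<Rightarrow> real" and \<theta> :: real and owner :: "nat \<Rightarrow> nat"
  assumes A: "A \<in> carrier_mat n n"
    and off: "\<And>i j. i < n \<Longrightarrow> j < n \<Longrightarrow> i \<noteq> j \<Longrightarrow> A $$ (i, j) \<le> 0"
    and w: "\<And>j. j < n \<Longrightarrow> 0 < w j"
    and aw: "\<And>i. i < n \<Longrightarrow> (\<Sum>j<n. A $$ (i, j) * w j) = 1"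
    and \<theta>: "0 \<le> \<theta>" "\<theta> < 1" "\<And>i. i < n \<Longrightarrow> (1 - \<theta>) * (\<Sum>j<n. \<bar>A $$ (i, j)\<bar> * w j) \<le> 1"
    and z: "z \<in> carrier_vec n" "A *\<^sub>v z = b"
    and sel: "\<And>s. s \<in> {1..p} \<Longrightarrow> selection_mat n (\<Omega> s) (R s)"
    and selc: "selection_mat n \<Omega>c Rc"
    and W: "\<And>s. s \<in> {1..p} \<Longrightarrow> W s \<in> carrier_mat (card (\<Omega> s)) (card (\<Omega> s))"
    and owner: "\<And>j. j < n \<Longrightarrow> owner j \<in> {1..p}" "\<And>j. j < n \<Longrightarrow> j \<in> \<Omega> (owner j)"
      "\<And>j y. j < n \<Longrightarrow> (\<And>r. r \<in> {1..p} \<Longrightarrow> y r \<in> carrier_vec (card (\<Omega> r))) \<Longrightarrow>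
       assembled n p R W y $ j = (transpose_mat (R (owner j)) *\<^sub>v y (owner j)) $ j"
begin

text \<open>Extension by zero makes this an error of the local copy only for
  \<open>j \<in> \<Omega> s\<close>; the bounds below use it only at unknowns owned by
  \<open>s\<close>.\<close>

definition err :: "nat \<Rightarrow> real vec \<Rightarrow> nat \<Rightarrow> real" where
  "err s u j = z $ j - (transpose_mat (R s) *\<^sub>v u) $ j"

lemma R: "s \<in> {1..p} \<Longrightarrow> R s \<in> carrier_mat (card (\<Omega> s)) n"
  using sel by (auto simp: selection_mat_def)

text \<open>Local and coarse steps share this estimate. The owners' errors form one global vector
  \<open>v\<close>, which determines the residual; an increment \<open>h\<close> that agrees at
  \<open>j\<close> with the subspace correction turns \<open>v\<close> into \<open>d\<close>
  there.\<close>

lemma correction_error_bound: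
  assumes Q: "selection_mat n \<Gamma> Q"
    and y: "\<And>r. r \<in> {1..p} \<Longrightarrow> y r \<in> carrier_vec (card (\<Omega> r))"
    and bound: "\<And>j. j < n \<Longrightarrow> \<bar>err (owner j) (y (owner j)) j\<bar> \<le> \<beta> * w j"
    and \<beta>: "0 \<le> \<beta>"
    and j: "j < n" "owner j = s"
    and h: "h \<in> carrier_vec (card (\<Omega> s))"
      "(transpose_mat (R s) *\<^sub>v h) $ j
        = (transpose_mat Q *\<^sub>v (mat_inv (restricted_mat A Q) *\<^sub>v restricted_residual p A b R W Q y)) $ j"
  shows "\<bar>err s (y s + h) j\<bar> \<le> \<beta> * w j"
    and "j \<in> \<Gamma> \<Longrightarrow> \<bar>err s (y s + h) j\<bar> \<le> \<theta> * \<beta> * w j"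
proof -
  have s: "s \<in> {1..p}" using owner(1)[OF j(1)] j(2) by simp
  have Qc: "Q \<in> carrier_mat (card \<Gamma>) n" using Q by (auto simp: selection_mat_def)
  define v where "v = z - assembled n p R W y"
  have asm: "assembled n p R W y \<in> carrier_vec n" by (rule assembled_carrier) (rule R)
  have v: "v \<in> carrier_vec n" using z(1) asm by (simp add: v_def)
  have v_err: "v $ i = err (owner i) (y (owner i)) i" if "i < n" for i
  proof -
    have "assembled n p R W y $ i = (transpose_mat (R (owner i)) *\<^sub>v y (owner i)) $ i"
      by (rule owner(3)[OF that]) (rule y)
    then show ?thesis using asm that by (simp add: v_def err_def)
  qed
  have res: "restricted_residual p A b R W Q y = Q *\<^sub>v (A *\<^sub>v v)"
    unfolding v_def by (rule restricted_residual_eq[OF A z Qc R W y])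
  define d where "d = v - transpose_mat Q *\<^sub>v (mat_inv (restricted_mat A Q) *\<^sub>v (Q *\<^sub>v (A *\<^sub>v v)))"
  have "transpose_mat (R s) *\<^sub>v (y s + h) = transpose_mat (R s) *\<^sub>v y s + transpose_mat (R s) *\<^sub>v h"
    by (rule mult_add_distrib_mat_vec[OF _ y[OF s] h(1)]) (use R[OF s] in simp)
  then have err_d: "err s (y s + h) j = d $ j"
    using v_err[OF j(1)] j h(2) carrier_matD(2)[OF Qc] carrier_matD(2)[OF R[OF s]]
    by (simp add: d_def err_def res)
  have v_le: "\<bar>v $ i\<bar> \<le> \<beta> * w i" if "i < n" for i
    using bound[OF that] v_err[OF that] by simp
  note bounds = subspace_correction_bound[OF A off w aw less_imp_le[OF \<theta>(2)] \<theta>(3) Q v v_le \<beta> j(1) d_def]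
  show "\<bar>err s (y s + h) j\<bar> \<le> \<beta> * w j" unfolding err_d by (rule bounds(1))
  show "\<bar>err s (y s + h) j\<bar> \<le> \<theta> * \<beta> * w j" if "j \<in> \<Gamma>"
    unfolding err_d using that by (rule bounds(2)[rotated -1])
qed

lemma mat_inv_restricted_carrier:
  assumes "selection_mat n \<Gamma> Q"
  shows "mat_inv (restricted_mat A Q) \<in> carrier_mat (card \<Gamma>) (card \<Gamma>)"
proof (rule mat_inv_inverse(1))
  show "restricted_mat A Q \<in> carrier_mat (card \<Gamma>) (card \<Gamma>)"
    using assms A by (auto simp: restricted_mat_def selection_mat_def)
  show "det (restricted_mat A Q) \<noteq> 0"
    by (rule restricted_mat_det_nonzero[OF A off w aw assms])
qed

lemma restricted_residual_carrier:
  assumes "selection_mat n \<Gamma> Q"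
    and "\<And>r. r \<in> {1..p} \<Longrightarrow> y r \<in> carrier_vec (card (\<Omega> r))"
  shows "restricted_residual p A b R W Q y \<in> carrier_vec (card \<Gamma>)"
proof -
  have Q: "Q \<in> carrier_mat (card \<Gamma>) n" using assms(1) by (auto simp: selection_mat_def)
  have "restricted_residual p A b R W Q y = Q *\<^sub>v (A *\<^sub>v (z - assembled n p R W y))"
    by (rule restricted_residual_eq[OF A z Q R W assms(2)])
  then show ?thesis using Q by (intro carrier_vecI) simp
qed

text \<open>This is the case \<open>Q = R s\<close>; an unknown owned by \<open>s\<close> lies in
  \<open>\<Omega> s\<close>, hence the factor \<open>\<theta>\<close>.\<close>

lemma local_map_error:
  assumes y: "\<And>r. r \<in> {1..p} \<Longrightarrow> y r \<in> carrier_vec (card (\<Omega> r))"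
    and bound: "\<And>j. j < n \<Longrightarrow> \<bar>err (owner j) (y (owner j)) j\<bar> \<le> \<beta> * w j"
    and \<beta>: "0 \<le> \<beta>"
    and j: "j < n" "owner j = s"
  shows "\<bar>err s (local_map p A b R W (schwarz_local A R) s y) j\<bar> \<le> \<theta> * \<beta> * w j"
proof -
  have s: "s \<in> {1..p}" using owner(1)[OF j(1)] j(2) by simp
  note c = mat_inv_restricted_carrier[OF sel[OF s]] restricted_residual_carrier[OF sel[OF s] y]
  show ?thesis
    unfolding local_map_def schwarz_local_def
    by (rule correction_error_bound(2)[OF sel[OF s] y bound \<beta> j])
      (use c owner(2)[OF j(1)] j(2) in auto)
qed

text \<open>An owned unknown may lie outside \<open>\<Omega>c\<close>, so the coarse step is only
  claimed not to enlarge the bound.\<close>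

lemma coarse_corrected_error:
  assumes x: "\<And>r. r \<in> {1..p} \<Longrightarrow> x r (\<delta> s r k) \<in> carrier_vec (card (\<Omega> r))"
    and bound: "\<And>j. j < n \<Longrightarrow> \<bar>err (owner j) (x (owner j) (\<delta> s (owner j) k)) j\<bar> \<le> \<beta> * w j"
    and \<beta>: "0 \<le> \<beta>"
    and j: "j < n" "owner j = s"
  shows "\<bar>err s (coarse_corrected p A b R W Rc \<delta> x s k) j\<bar> \<le> \<beta> * w j"
proof -
  have s: "s \<in> {1..p}" using owner(1)[OF j(1)] j(2) by simp
  obtain \<sigma> where bij: "bij_betw \<sigma> {..<card (\<Omega> s)} (\<Omega> s)"
    and Rv: "\<And>v i. v \<in> carrier_vec n \<Longrightarrow> i < card (\<Omega> s) \<Longrightarrow> (R s *\<^sub>v v) $ i = v $ \<sigma> i"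
    and Rt: "\<And>y i. y \<in> carrier_vec (card (\<Omega> s)) \<Longrightarrow> i < card (\<Omega> s) \<Longrightarrow> (transpose_mat (R s) *\<^sub>v y) $ \<sigma> i = y $ i"
    using selection_matE[OF sel[OF s]] by metis
  from bij owner(2)[OF j(1)] j(2) obtain i where i: "i < card (\<Omega> s)" "j = \<sigma> i"
    by (auto simp: bij_betw_def)
  let ?res = "restricted_residual p A b R W Rc (\<lambda>r. x r (\<delta> s r k))"
  let ?c = "transpose_mat Rc *\<^sub>v (mat_inv (restricted_mat A Rc) *\<^sub>v ?res)"
  note inv = mat_inv_restricted_carrier[OF selc]
  have res: "?res \<in> carrier_vec (card \<Omega>c)" 
    by (rule restricted_residual_carrier[OF selc]) (rule x)
  have Rc: "Rc \<in> carrier_mat (card \<Omega>c) n" using selc by (auto simp: selection_mat_def)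
  have RsRc: "R s * transpose_mat Rc \<in> carrier_mat (card (\<Omega> s)) (card \<Omega>c)"
    using R[OF s] Rc by simp
  have Rct: "transpose_mat Rc \<in> carrier_mat n (card \<Omega>c)" using Rc by simp
  have inv_res: "mat_inv (restricted_mat A Rc) *\<^sub>v ?res \<in> carrier_vec (card \<Omega>c)"
    using inv res by (rule mult_mat_vec_carrier)
  have c: "?c \<in> carrier_vec n" using Rct inv_res by (rule mult_mat_vec_carrier)
  have h_eq: "(R s * transpose_mat Rc * mat_inv (restricted_mat A Rc)) *\<^sub>v ?res = R s *\<^sub>v ?c"
    unfolding assoc_mult_mat_vec[OF RsRc inv res] assoc_mult_mat_vec[OF R[OF s] Rct inv_res] ..
  have h: "R s *\<^sub>v ?c \<in> carrier_vec (card (\<Omega> s))" using R[OF s] c by simp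
  \<comment> \<open>Since \<open>j \<in> \<Omega> s\<close>, restricting to
    \<open>\<Omega> s\<close> and extending by zero returns the coarse correction at
    \<open>j\<close>, as required of the increment.\<close>
  have eq: "(transpose_mat (R s) *\<^sub>v (R s *\<^sub>v ?c)) $ j = ?c $ j"
    unfolding i(2) Rt[OF h i(1)] Rv[OF c i(1)] ..
  show ?thesis
    unfolding coarse_corrected_def h_eq
    by (rule correction_error_bound(1)[where y = "\<lambda>r. x r (\<delta> s r k)", OF selc x bound \<beta> j h eq])
qed

lemma coarse_corrected_carrier:
  "s \<in> {1..p} \<Longrightarrow> coarse_corrected p A b R W Rc \<delta> x s k \<in> carrier_vec (card (\<Omega> s))"
  \<comment> \<open>A vector sum takes its dimension from the right summand, here a product with as
    many rows as \<open>R s\<close>.\<close>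
  using R[of s] by (intro carrier_vecI) (simp add: coarse_corrected_def)

lemma local_map_carrier:
  assumes "s \<in> {1..p}"
  shows "local_map p A b R W (schwarz_local A R) s y \<in> carrier_vec (card (\<Omega> s))"
  using mat_inv_restricted_carrier[OF sel[OF assms]]
  by (intro carrier_vecI) (simp add: local_map_def schwarz_local_def)

lemma iterates_step:
  assumes "two_level_schwarz_iterates p A b R W Rc S \<delta> x" and "s \<in> {1..p}"
  shows "s \<in> S k \<Longrightarrow> x s (Suc k) = local_map p A b R W (schwarz_local A R) s
      (\<lambda>r. coarse_corrected p A b R W Rc \<delta> x r (\<delta> s r k))"
    and "s \<notin> S k \<Longrightarrow> x s (Suc k) = x s k"
proof -
  have "x s (Suc k) = (if s \<in> S k
      then local_map p A b R W (schwarz_local A R) s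
        (\<lambda>r. coarse_corrected p A b R W Rc \<delta> x r (\<delta> s r k))
      else x s k)"
    using assms unfolding two_level_schwarz_iterates_def by blast
  then show "s \<in> S k \<Longrightarrow> x s (Suc k) = local_map p A b R W (schwarz_local A R) s
      (\<lambda>r. coarse_corrected p A b R W Rc \<delta> x r (\<delta> s r k))"
    and "s \<notin> S k \<Longrightarrow> x s (Suc k) = x s k"
    by (simp_all only: if_True if_False)
qed

lemma iterates_carrier:
  assumes it: "two_level_schwarz_iterates p A b R W Rc S \<delta> x" and s: "s \<in> {1..p}"
  shows "x s k \<in> carrier_vec (card (\<Omega> s))"
proof (induction k)
  case 0
  have "x s 0 \<in> carrier_vec (dim_row (R s))"
    using it s unfolding two_level_schwarz_iterates_def by blast
  then show ?case unfolding carrier_matD(1)[OF R[OF s]] .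
next
  case (Suc k)
  then show ?case
    using iterates_step[OF it s, of k] local_map_carrier[OF s] by (cases "s \<in> S k") simp_all
qed

lemma iterates_converge:
  assumes sched: "async_schedule p S \<delta>"
    and it: "two_level_schwarz_iterates p A b R W Rc S \<delta> x"
    and i: "i < n"
  shows "(\<lambda>k. assembled n p R W (\<lambda>s. x s k) $ i) \<longlonglongrightarrow> z $ i"
proof -
  note x = iterates_carrier[OF it]
  \<comment> \<open>The sum of the initial ratios is at least each of them, so
    \<open>\<beta> * w\<close> bounds all owned initial errors.\<close>
  define \<beta> where "\<beta> = (\<Sum>j<n. \<bar>err (owner j) (x (owner j) 0) j\<bar> / w j)"
  have term0: "0 \<le> \<bar>err (owner j) (x (owner j) 0) j\<bar> / w j" if "j < n" for j
    using w[OF that] by simp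
  have \<beta>: "0 \<le> \<beta>" unfolding \<beta>_def by (rule sum_nonneg) (use term0 in auto)
  have start: "\<bar>err (owner j) (x (owner j) 0) j\<bar> \<le> \<beta> * w j" if "j < n" for j
  proof -
    have "\<bar>err (owner j) (x (owner j) 0) j\<bar> / w j \<le> \<beta>"
      unfolding \<beta>_def by (rule member_le_sum) (use term0 that in auto)
    then show ?thesis using w[OF that] by (simp add: pos_divide_le_eq)
  qed
  \<comment> \<open>Only unknowns owned by \<open>s\<close> are recorded: the other entries of its
    copy get weight 0 and never reach a residual.\<close>
  define Q where "Q m s k \<longleftrightarrow> (\<forall>j<n. owner j = s \<longrightarrow> \<bar>err s (x s k) j\<bar> \<le> \<theta> ^ m * \<beta> * w j)" for m s k
  have level: "\<forall>\<^sub>F k in sequentially. \<forall>s\<in>{1..p}. Q m s k" for m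
  proof (rule async_level_convergence[OF sched])
    show "Q 0 s 0" for s using start by (auto simp: Q_def)
  next
    fix m s k assume Q: "Q (Suc m) s k"
    have "\<theta> ^ Suc m * \<beta> * w j \<le> \<theta> ^ m * \<beta> * w j" if "j < n" for j
      using \<theta> \<beta> w[OF that] by (intro mult_right_mono power_decreasing) auto
    with Q show "Q m s k" unfolding Q_def using order_trans by blast
  next
    fix m s k assume s: "s \<in> {1..p}" "s \<notin> S k" and "Q m s k"
    then show "Q m s (Suc k)" unfolding Q_def iterates_step(2)[OF it s] by blast
  next
    fix m s k assume s: "s \<in> S k"
      and Q: "\<And>r q. r \<in> {1..p} \<Longrightarrow> q \<in> {1..p} \<Longrightarrow> Q m q (\<delta> r q (\<delta> s r k))"
    have s': "s \<in> {1..p}" using s sched unfolding async_schedule_def by blast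
    let ?y = "\<lambda>r. coarse_corrected p A b R W Rc \<delta> x r (\<delta> s r k)"
    have \<beta>m: "0 \<le> \<theta> ^ m * \<beta>" using \<theta>(1) \<beta> by simp
    \<comment> \<open>The vector read from process \<open>owner j\<close> was corrected there at
      index \<open>\<delta> s (owner j) k\<close>, so its inputs carry the composed delay for which
      level \<open>m\<close> is known.\<close>
    have y: "\<bar>err (owner j) (?y (owner j)) j\<bar> \<le> \<theta> ^ m * \<beta> * w j" if j: "j < n" for j
    proof (rule coarse_corrected_error[where x = x and \<delta> = \<delta>, OF _ _ \<beta>m j refl])
      show "\<bar>err (owner i) (x (owner i) (\<delta> (owner j) (owner i) (\<delta> s (owner j) k))) i\<bar> \<le> \<theta> ^ m * \<beta> * w i"
        if "i < n" for i
        using Q[OF owner(1)[OF j] owner(1)[OF that]] that by (simp add: Q_def)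
    qed (rule x)
    have "\<bar>err s (x s (Suc k)) j\<bar> \<le> \<theta> ^ Suc m * \<beta> * w j" if j: "j < n" "owner j = s" for j
    proof -
      have "\<bar>err s (x s (Suc k)) j\<bar> \<le> \<theta> * (\<theta> ^ m * \<beta>) * w j"
        unfolding iterates_step(1)[OF it s' s]
        by (rule local_map_error[OF _ y \<beta>m j]) (rule coarse_corrected_carrier)
      then show ?thesis by (simp add: mult.assoc)
    qed
    then show "Q (Suc m) s (Suc k)" unfolding Q_def by blast
  qed
  have small: "(\<lambda>m. \<theta> ^ m * \<beta> * w i) \<longlonglongrightarrow> 0"
    using LIMSEQ_realpow_zero[OF \<theta>(1,2)] by (auto intro!: tendsto_mult_left_zero)
  show ?thesis
  proof (rule tendstoI)
    fix e :: real assume "0 < e"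
    \<comment> \<open>First \<open>m\<close> is fixed so that the bound at \<open>i\<close> is below
      \<open>e\<close>; level \<open>m\<close> then holds for all large \<open>k\<close>.\<close>
    with small have "\<forall>\<^sub>F m in sequentially. \<theta> ^ m * \<beta> * w i < e" by (rule order_tendstoD)
    then obtain m where m: "\<theta> ^ m * \<beta> * w i < e" by (auto simp: eventually_sequentially)
    show "\<forall>\<^sub>F k in sequentially. dist (assembled n p R W (\<lambda>s. x s k) $ i) (z $ i) < e"
      using level[of m]
    proof eventually_elim
      case (elim k)
      then have "\<bar>err (owner i) (x (owner i) k) i\<bar> < e"
        using owner(1)[OF i] i m by (force simp: Q_def)
      moreover have "assembled n p R W (\<lambda>s. x s k) $ i
          = (transpose_mat (R (owner i)) *\<^sub>v x (owner i) k) $ i"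
        by (rule owner(3)[OF i]) (rule x)
      ultimately show ?case by (simp add: err_def dist_real_def abs_minus_commute)
    qed
  qed
qed

end

section \<open>Choice of the constants and conclusion\<close>

theorem theorem2:
  fixes n p :: nat and A Rc :: "real mat" and b :: "real vec"
    and \<Omega> :: "nat \<Rightarrow> nat set" and \<Omega>c :: "nat set" and R W :: "nat \<Rightarrow> real mat"
  assumes "p \<le> n"
    and "A \<in> carrier_mat n n" and "b \<in> carrier_vec n"
    and "\<forall>s\<in>{1..p}. selection_mat n (\<Omega> s) (R s)"
    and "diagonal_weights n p R W"
    and "\<forall>s\<in>{1..p}. \<forall>i<dim_row (W s). W s $$ (i, i) \<in> {0, 1}"
    and "selection_mat n \<Omega>c Rc"
    and "\<forall>s\<in>{1..p}. common_row Rc (R s)"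
    and "M_matrix A"
  shows "two_level_schwarz_convergent n p A b R W Rc"
proof -
  note A = assms(2) and b = assms(3) and sel = assms(4) and M = assms(9)
  obtain w where w: "\<And>j. j < n \<Longrightarrow> 0 < w j" "\<And>i. i < n \<Longrightarrow> (\<Sum>j<n. A $$ (i, j) * w j) = 1"
    using M_matrix_positive_vector[OF A M] by metis
  have "det A \<noteq> 0" using M invertible_mat_det_nonzero by (auto simp: M_matrix_def)
  note inv = mat_inv_inverse[OF A this]
  define z where "z = mat_inv A *\<^sub>v b"
  have z: "z \<in> carrier_vec n" "A *\<^sub>v z = b"
    using assoc_mult_mat_vec[OF A inv(1) b] inv b by (auto simp: z_def)
  define rs where "rs i = (\<Sum>j<n. \<bar>A $$ (i, j)\<bar> * w j)" for i
  have rs: "0 \<le> rs i" for i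
    unfolding rs_def by (rule sum_nonneg) (use w(1) in \<open>auto simp: less_imp_le\<close>)
  \<comment> \<open>Here \<open>1 - \<theta>\<close> is the reciprocal of a number that is at least
    every \<open>rs i\<close>; the added 1 keeps the denominator at least 1, whence \<theta> is
    nonnegative and below 1.\<close>
  define \<theta> where "\<theta> = 1 - 1 / (1 + (\<Sum>i<n. rs i))"
  have total: "0 \<le> (\<Sum>i<n. rs i)" by (rule sum_nonneg) (rule rs)
  have \<theta>: "0 \<le> \<theta>" "\<theta> < 1" using total by (auto simp: \<theta>_def)
  have \<theta>_rs: "(1 - \<theta>) * rs i \<le> 1" if "i < n" for i
  proof -
    have "rs i \<le> (\<Sum>i<n. rs i)" by (rule member_le_sum) (use rs that in auto)
    then show ?thesis using total by (simp add: \<theta>_def)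
  qed
  \<comment> \<open>Object-level quantifiers let \<open>metis\<close> choose the owner as a function
    of \<open>j\<close>.\<close>
  have "\<exists>s. s \<in> {1..p} \<and> j \<in> \<Omega> s \<and>
      (\<forall>y. (\<forall>r\<in>{1..p}. y r \<in> carrier_vec (card (\<Omega> r))) \<longrightarrow>
        assembled n p R W y $ j = (transpose_mat (R s) *\<^sub>v y s) $ j)" if j: "j < n" for j
    using assembled_owner[OF sel assms(5,6) j] by metis
  then obtain owner where owner: "\<And>j. j < n \<Longrightarrow> owner j \<in> {1..p} \<and> j \<in> \<Omega> (owner j) \<and>
      (\<forall>y. (\<forall>r\<in>{1..p}. y r \<in> carrier_vec (card (\<Omega> r))) \<longrightarrow>
        assembled n p R W y $ j = (transpose_mat (R (owner j)) *\<^sub>v y (owner j)) $ j)"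
    by metis
  interpret two_level_schwarz n p A Rc b z \<Omega> \<Omega>c R W w \<theta> owner
  proof
    show "A $$ (i, j) \<le> 0" if "i < n" "j < n" "i \<noteq> j" for i j
      using M A that by (auto simp: M_matrix_def)
    show "W s \<in> carrier_mat (card (\<Omega> s)) (card (\<Omega> s))" if "s \<in> {1..p}" for s
      using assms(5) sel that unfolding diagonal_weights_def selection_mat_def
      by (metis carrier_matD(1))
  qed (use A w \<theta> \<theta>_rs z sel assms(7) owner in \<open>auto simp: rs_def\<close>)
  show ?thesis
    unfolding two_level_schwarz_convergent_def using z iterates_converge by blast
qed

end
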